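(* Let $\mu\in\mathcal{P}(\mathbb{R})$ have finite variance $\sigma^2$, and let $a\in\mathbb{R}$, $b\ge2\sigma$. Then $\mathbb{A}_{a,b}(\mu)\in\mathcal{UI}$; in particular $\mathbb{A}_{a,b}(\mu)$ is freely infinitely divisible.
   Context: For $\mu\in\mathcal{P}(\mathbb{R})$: $G_\mu(z)=\int\frac{1}{z-x}\mu(dx)$, $F_\mu=1/G_\mu$ on $\mathbb{C}^+$; $F_\mu$ has a univalent left inverse $F_\mu^{-1}$ on some truncated cone $\Gamma_{\lambda,M}=\{z\in\mathbb{C}^+:|\mathrm{Re}\,z|<\lambda\mathrm{Im}\,z,\ \mathrm{Im}\,z>M\}$. A probability measure $\mu$ is in class $\mathcal{UI}$ if $F_\mu^{-1}$ extends from some $\Gamma_{\lambda,M}$ to a univalent function on $\mathbb{C}^+$ (every measure in $\mathcal{UI}$ is $\boxplus$-infinitely divisible). $\mathbb{A}_\sigma(\mu)$ is the unique probability measure with $\sigma\boxplus\mu=\sigma\rhd\mathbb{A}_\sigma(\mu)$ ($\boxplus$ additive free, $\rhd$ additive monotone convolution, $F_{\mu\rhd\nu}=F_\mu\circ F_\nu$). $\mathbb{A}_{a,b}:=\mathbb{A}_{\mathbf{c}_{a,b}}$ with $\mathbf{c}_{a,b}$ the Cauchy law with density $\frac{b}{\pi((x-a)^2+b^2)}$; equivalently $F_{\mathbb{A}_{a,b}(\mu)}(z)=F_\mu(z-a+ib)+a-ib$. *)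

theory Defs
  imports "HOL-Probability.Probability"
begin

definition upper_half :: "complex set" where
  "upper_half = {z. Im z > 0}"

definition trunc_cone :: "real \<Rightarrow> real \<Rightarrow> complex set" where
  "trunc_cone l M = {z. 0 < Im z \<and> \<bar>Re z\<bar> < l * Im z \<and> Im z > M}"

definition cauchy_transform :: "real measure \<Rightarrow> complex \<Rightarrow> complex" where
  "cauchy_transform \<mu> z = (\<integral>x. 1 / (z - complex_of_real x) \<partial>\<mu>)"

definition F_transform :: "real measure \<Rightarrow> complex \<Rightarrow> complex" where
  "F_transform \<mu> z = 1 / cauchy_transform \<mu> z"

definition real_prob_measure :: "real measure \<Rightarrow> bool" where
  "real_prob_measure \<mu> \<longleftrightarrow> prob_space \<mu> \<and> sets \<mu> = sets borel"

text \<open>Class UI: the left inverse F_mu^{-1} (the inverse of F_mu restricted to a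
  truncated cone on which F_mu is univalent, defined on a smaller truncated cone)
  extends to a univalent (injective holomorphic) function on the upper half plane.\<close>
definition class_UI :: "real measure \<Rightarrow> bool" where
  "class_UI \<mu> \<longleftrightarrow>
     (\<exists>\<phi> :: complex \<Rightarrow> complex.
        \<phi> holomorphic_on upper_half \<and> inj_on \<phi> upper_half \<and>
        (\<exists>\<alpha> \<beta> l M. 0 < \<alpha> \<and> 0 < \<beta> \<and> 0 < l \<and> 0 < M \<and>
           inj_on (F_transform \<mu>) (trunc_cone \<alpha> \<beta>) \<and>
           (\<forall>z \<in> trunc_cone l M. \<phi> z \<in> trunc_cone \<alpha> \<beta> \<and> F_transform \<mu> (\<phi> z) = z)))"

definition is_A_ab :: "real \<Rightarrow> real \<Rightarrow> real measure \<Rightarrow> real measure \<Rightarrow> bool" where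
  "is_A_ab a b \<mu> \<nu> \<longleftrightarrow> real_prob_measure \<nu> \<and>
     (\<forall>z \<in> upper_half. F_transform \<nu> z =
        F_transform \<mu> (z - complex_of_real a + \<i> * complex_of_real b)
          + complex_of_real a - \<i> * complex_of_real b)"

end

theory Submission
  imports Defs "HOL-Complex_Analysis.Complex_Analysis"
begin

text \<open>Write \<open>F(w) = w - m + H(w)\<close> with \<open>m\<close> the mean and \<open>s^2\<close> the variance of the measure.
  Covariance identities for the resolvents \<open>1 / (w - x)\<close> and the Cauchy--Schwarz inequality give
  \<open>Im H \<ge> 0\<close>, \<open>\<bar>H w\<bar> Im w \<le> s^2\<close> and \<open>\<bar>H w - H z\<bar> Im w Im z \<le> s^2 \<bar>w - z\<bar>\<close>, with no
  need for the Nevanlinna representation. Hence \<open>F\<close> is injective on \<open>Im w > s\<close>, and by the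
  contraction principle its image contains \<open>Im w > 2 s\<close>; shifting by \<open>b \<ge> 2 s\<close> turns its inverse
  into a univalent function on the whole upper half plane. For the existence of the transformed
  measure, the shifted function has positive imaginary part up to the real axis unless
  \<open>H\<close> is constant (the measure is then a point mass and its own transform), so its reciprocal is the Cauchy transform of an explicit continuous density.\<close>

subsection \<open>Functions on the closed upper half plane\<close>

lemma integrable_lborel_quadratic_decay:
  fixes f :: "real \<Rightarrow> 'a::euclidean_space"
  assumes cont: "continuous_on UNIV f" and R: "0 < R"
    and le: "\<And>x. R \<le> \<bar>x\<bar> \<Longrightarrow> norm (f x) \<le> C / x\<^sup>2"
  shows "integrable lborel f"
proof -
  have "compact (f ` {-R..R})"
    using cont by (intro compact_continuous_image) (auto intro: continuous_on_subset)
  then obtain B where B: "\<And>x. x \<in> {-R..R} \<Longrightarrow> norm (f x) \<le> B"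
    using compact_imp_bounded bounded_iff by (metis imageI)
  have B0: "0 \<le> B" using B[of 0] R by (smt (verit) atLeastAtMost_iff norm_ge_zero)
  have "0 \<le> C / R\<^sup>2" using le[of R] R by (smt (verit) norm_ge_zero)
  then have C0: "0 \<le> C" using R by (simp add: zero_le_divide_iff)
  \<comment> \<open>One summand for each region: the first dominates
    \<open>norm (f x) * (1 + x^2)\<close> for \<open>|x| \<le> R\<close>, the second outside. Both
    are nonnegative, so the sum serves everywhere.\<close>
  define D where "D = B * (1 + R\<^sup>2) + C * (1 + 1 / R\<^sup>2)"
  have "norm (f x) \<le> norm (D * inverse (1 + x\<^sup>2))" for x
  proof -
    have pos: "0 < 1 + x\<^sup>2" by (smt (verit) zero_le_power2)
    have "norm (f x) * (1 + x\<^sup>2) \<le> D"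
    proof (cases "\<bar>x\<bar> \<le> R")
      case True
      then have "x\<^sup>2 \<le> R\<^sup>2" using R by (simp add: abs_le_square_iff[symmetric])
      moreover have "norm (f x) \<le> B" using True by (intro B) (auto simp: abs_le_iff)
      ultimately have "norm (f x) * (1 + x\<^sup>2) \<le> B * (1 + R\<^sup>2)"
        using B0 by (intro mult_mono) auto
      moreover have "0 \<le> C * (1 + 1 / R\<^sup>2)" using C0 by simp
      ultimately show ?thesis unfolding D_def by linarith
    next
      case False
      then have "R\<^sup>2 \<le> x\<^sup>2" using R by (simp add: abs_le_square_iff[symmetric])
      then have i: "1 / x\<^sup>2 \<le> 1 / R\<^sup>2" using R by (intro divide_left_mono) (auto intro!: mult_pos_pos)
      have "x \<noteq> 0" using False R by auto
      have "norm (f x) * (1 + x\<^sup>2) \<le> C / x\<^sup>2 * (1 + x\<^sup>2)"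
        using le[of x] False pos by (intro mult_right_mono) auto
      also have "\<dots> = C * (1 + 1 / x\<^sup>2)" using \<open>x \<noteq> 0\<close> by (simp add: field_simps)
      also have "\<dots> \<le> C * (1 + 1 / R\<^sup>2)" using C0 i by (intro mult_left_mono) auto
      moreover have "0 \<le> B * (1 + R\<^sup>2)" using B0 by simp
      ultimately show ?thesis unfolding D_def by linarith
    qed
    then have "norm (f x) \<le> D * inverse (1 + x\<^sup>2)" using pos by (simp add: field_simps)
    then show ?thesis by (metis abs_ge_self order_trans real_norm_def)
  qed
  moreover have "integrable lborel (\<lambda>x::real. D * inverse (1 + x\<^sup>2))"
    using integrable_inverse_1_plus_square by (simp add: set_integrable_def)
  moreover have "f \<in> borel_measurable lborel"
    using borel_measurable_continuous_onI[OF cont] by simp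
  ultimately show ?thesis
    using Bochner_Integration.integrable_bound[of lborel "\<lambda>x. D * inverse (1 + x\<^sup>2)" f] AE_I2 by blast
qed

lemma convex_closed_upper_half_plane: "convex {w. 0 \<le> Im w}"
  using convex_halfspace_ge[of 0 \<i>] by (simp add: inner_complex_def)

lemma interior_closed_upper_half_plane: "0 < Im z \<Longrightarrow> z \<in> interior {w. 0 \<le> Im w}"
  using open_halfspace_Im_gt[of 0] by (auto intro!: interiorI[of "{w. 0 < Im w}"])

text \<open>The segment from \<open>-R\<close> to \<open>R\<close> is closed up by the upper half
  circle, which contributes at most \<open>C * pi / R\<close>. Holomorphy on the closed half plane
  means differentiability within it; Cauchy's theorem for convex sets applies in this form, so the
  contour may run along the boundary.\<close>

lemma integral_real_line_eq_0:
  assumes holo: "Q holomorphic_on {w. 0 \<le> Im w}" and R0: "0 < R0"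
    and le: "\<And>w. 0 \<le> Im w \<Longrightarrow> R0 \<le> cmod w \<Longrightarrow> cmod (Q w) \<le> C / (cmod w)\<^sup>2"
  shows "integrable lborel (\<lambda>x. Q (complex_of_real x))"
    and "(\<integral>x. Q (complex_of_real x) \<partial>lborel) = 0"
proof -
  let ?q = "\<lambda>x. Q (complex_of_real x)"
  have contQ: "continuous_on {w. 0 \<le> Im w} Q" using holo by (rule holomorphic_on_imp_continuous_on)
  then have cont: "continuous_on UNIV ?q"
    by (rule continuous_on_compose2) (auto intro!: continuous_intros)
  show int: "integrable lborel ?q"
  proof (rule integrable_lborel_quadratic_decay[OF cont R0])
    show "cmod (?q x) \<le> C / x\<^sup>2" if "R0 \<le> \<bar>x\<bar>" for x
      using le[of "complex_of_real x"] that by simp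
  qed
  have C0: "0 \<le> C"
  proof -
    have "0 \<le> C / R0\<^sup>2" using le[of "of_real R0"] R0
      by (metis Im_complex_of_real abs_of_pos norm_ge_zero norm_of_real order.refl order.trans)
    then show ?thesis using R0 by (simp add: zero_le_divide_iff)
  qed
  have bound: "cmod (LINT x:{-R..R}|lborel. ?q x) \<le> C * pi / R" if R: "R0 \<le> R" for R
  proof -
    let ?l = "linepath (complex_of_real (-R)) (complex_of_real R)" and ?c = "part_circlepath 0 R 0 pi"
    have R_pos: "0 < R" using R R0 by linarith
    have l: "path_image ?l \<subseteq> {w. 0 \<le> Im w}"
      unfolding path_image_linepath by (rule closed_segment_subset) (auto simp: convex_closed_upper_half_plane)
    have c: "path_image ?c \<subseteq> {w. 0 \<le> Im w}"
      using R_pos by (auto simp: path_image_part_circlepath' closed_segment_eq_real_ivl sin_ge_zero)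
    have il: "Q contour_integrable_on ?l"
      using contQ l by (intro contour_integrable_continuous_linepath) (auto intro: continuous_on_subset)
    have ic: "Q contour_integrable_on ?c"
      using contQ c by (intro contour_integrable_continuous_part_circlepath) (auto intro: continuous_on_subset)
    have join: "pathfinish ?l = pathstart ?c" and closed: "pathfinish ?c = pathstart ?l"
      by (simp_all add: exp_eq_polar)
    have "(Q has_contour_integral 0) (?l +++ ?c)"
      using l c join closed
      by (intro Cauchy_theorem_convex_simple[OF holo convex_closed_upper_half_plane])
         (auto simp: path_image_join valid_path_join)
    then have "contour_integral ?l Q + contour_integral ?c Q = 0"
      using contour_integral_join[OF il ic] by (simp add: contour_integral_unique)
    then have "cmod (contour_integral ?l Q) = cmod (contour_integral ?c Q)"
      by (metis add_eq_0_iff norm_minus_cancel)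
    also have "\<dots> \<le> C / R\<^sup>2 * R * \<bar>pi - 0\<bar>"
    proof (rule contour_integral_bound_part_circlepath[OF ic])
      fix w assume w: "w \<in> path_image ?c"
      then have "cmod w = R" using in_path_image_part_circlepath[OF w] R_pos by simp
      then show "cmod (Q w) \<le> C / R\<^sup>2" using le[of w] R w c by auto
    qed (use C0 R_pos in auto)
    also have "C / R\<^sup>2 * R * \<bar>pi - 0\<bar> = C * pi / R"
      using R_pos by (simp add: power2_eq_square)
    also have "contour_integral ?l Q = integral {-R..R} ?q"
      using R_pos by (subst contour_integral_linepath_Reals_eq) auto
    also have "\<dots> = (LINT x:{-R..R}|lborel. ?q x)"
      by (rule set_borel_integral_eq_integral(2)[symmetric], rule borel_integrable_atLeastAtMost')
         (use cont continuous_on_subset in blast)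
    finally show ?thesis .
  qed
  have "((\<lambda>R. LINT x:{-R..R}|lborel. ?q x) \<longlongrightarrow> 0) at_top"
  proof (rule Lim_null_comparison)
    show "\<forall>\<^sub>F R in at_top. cmod (LINT x:{-R..R}|lborel. ?q x) \<le> C * pi / R"
      using eventually_ge_at_top[of R0] by eventually_elim (rule bound)
    show "((\<lambda>R. C * pi / R) \<longlongrightarrow> 0) at_top"
      by (intro tendsto_divide_0[OF tendsto_const] filterlim_at_top_imp_at_infinity filterlim_ident)
  qed
  \<comment> \<open>The truncated integrals tend to 0 and also, by dominated convergence along
    integer radii, to the integral over the whole line.\<close>
  then have "(\<lambda>n. LINT x:{-real n..real n}|lborel. ?q x) \<longlonglongrightarrow> 0"
    by (rule filterlim_compose) (rule filterlim_real_sequentially)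
  moreover have "(\<lambda>n. LINT x:{-real n..real n}|lborel. ?q x) \<longlonglongrightarrow> (\<integral>x. ?q x \<partial>lborel)"
    unfolding set_lebesgue_integral_def
  proof (rule integral_dominated_convergence[where w = "\<lambda>x. cmod (?q x)"])
    show "AE x in lborel. (\<lambda>n. indicat_real {-real n..real n} x *\<^sub>R ?q x) \<longlonglongrightarrow> ?q x"
    proof (rule AE_I2)
      fix x :: real
      have "\<forall>\<^sub>F n in sequentially. nat \<lceil>\<bar>x\<bar>\<rceil> \<le> n" by (rule eventually_ge_at_top)
      then have "\<forall>\<^sub>F n in sequentially. indicat_real {-real n..real n} x *\<^sub>R ?q x = ?q x"
      proof eventually_elim
        case (elim n)
        then have "\<bar>x\<bar> \<le> real n" by linarith
        then show ?case by (auto simp: indicator_def)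
      qed
      then show "(\<lambda>n. indicat_real {-real n..real n} x *\<^sub>R ?q x) \<longlonglongrightarrow> ?q x"
        by (rule tendsto_eventually)
    qed
  qed (use int in \<open>auto simp: indicator_def\<close>)
  ultimately show "(\<integral>x. ?q x \<partial>lborel) = 0"
    using LIMSEQ_unique by blast
qed

text \<open>The substitution \<open>x \<mapsto> Re z + Im z * x\<close> leads to
  \<open>1 / (1 + x^2)\<close>. The kernel is kept without its usual factor
  \<open>1 / pi\<close>.\<close>

lemma integral_poisson_kernel:
  assumes "0 < Im z"
  shows "(\<integral>x. Im z / (cmod (complex_of_real x - z))\<^sup>2 \<partial>lborel) = pi"
proof -
  let ?f = "\<lambda>x. Im z / (cmod (complex_of_real x - z))\<^sup>2"
  have "(\<integral>x. ?f x \<partial>lborel) = \<bar>Im z\<bar> *\<^sub>R (\<integral>x. ?f (Re z + Im z * x) \<partial>lborel)"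
    using assms by (intro lborel_integral_real_affine) simp
  also have "(\<lambda>x. ?f (Re z + Im z * x)) = (\<lambda>x. (1 / Im z) * inverse (1 + x\<^sup>2))"
  proof
    fix x :: real
    have "1 + x\<^sup>2 \<noteq> 0" by (smt (verit) zero_le_power2)
    moreover have "(cmod (complex_of_real (Re z + Im z * x) - z))\<^sup>2 = (Im z)\<^sup>2 * (1 + x\<^sup>2)"
      unfolding cmod_power2 by simp algebra
    ultimately show "?f (Re z + Im z * x) = (1 / Im z) * inverse (1 + x\<^sup>2)"
      using assms by (simp add: divide_simps power2_eq_square)
  qed
  also have "(\<integral>x. (1 / Im z) * inverse (1 + x\<^sup>2) \<partial>lborel) = (1 / Im z) * pi"
    using LBINT_inverse_1_plus_square
    by (simp add: interval_lebesgue_integral_def set_lebesgue_integral_def)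
  finally show ?thesis using assms by simp
qed

text \<open>Cauchy's theorem in the upper half plane, applied to \<open>G w / (w - cnj z)\<close> and to
  \<open>G w / (w - z)\<close> with its pole at \<open>z\<close> cancelled by a multiple of the Poisson kernel, recovers
  \<open>G\<close> from the imaginary part of its boundary values.\<close>

lemma stieltjes_inversion_upper_half_plane:
  assumes holo: "G holomorphic_on {w. 0 \<le> Im w}" and R0: "0 < R0"
    and le: "\<And>w. 0 \<le> Im w \<Longrightarrow> R0 \<le> cmod w \<Longrightarrow> cmod (G w) \<le> C / cmod w"
    and z: "0 < Im z"
  shows "(\<integral>x. complex_of_real (- Im (G (complex_of_real x)) / pi) / (z - complex_of_real x) \<partial>lborel) = G z"
proof -
  \<comment> \<open>Beyond \<open>2 * cmod z\<close> both \<open>w - z\<close> and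
    \<open>w - cnj z\<close> have modulus at least \<open>cmod w / 2\<close>, so each division by
    them gains a power of decay.\<close>
  define R where "R = max R0 (2 * cmod z + 1)"
  have R: "R0 \<le> R" "0 < R" using R0 by (auto simp: R_def)
  have C0: "0 \<le> C"
  proof -
    have "0 \<le> C / R0" using le[of "of_real R0"] R0
      by (metis Im_complex_of_real abs_of_pos norm_ge_zero norm_of_real order.refl order.trans)
    then show ?thesis using R0 by (simp add: zero_le_divide_iff)
  qed
  have far: "cmod w / 2 \<le> cmod (w - z)" "cmod w / 2 \<le> cmod (w - cnj z)" "0 < cmod w" if "R \<le> cmod w" for w
    using norm_triangle_ineq2[of w z] norm_triangle_ineq2[of w "cnj z"] that R unfolding R_def
    by (auto simp del: complex_mod_cnj simp add: complex_mod_cnj[of z])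
  have nz: "w - cnj z \<noteq> 0" if "0 \<le> Im w" for w
    using that z by (auto simp: complex_eq_iff)
  \<comment> \<open>The subtracted term equals \<open>G z\<close> at \<open>w = z\<close>, and its
    only possible pole \<open>cnj z\<close> lies outside the half plane. Thus \<open>N\<close>
    vanishes at \<open>z\<close>, and \<open>Q\<close> is \<open>N w / (w - z)\<close> with the
    singularity removed.\<close>
  define N where "N w = G w - G z * (z - cnj z) / (w - cnj z)" for w
  define Q where "Q w = (if w = z then deriv N z else (N w - N z) / (w - z))" for w
  define P where "P w = G w / (w - cnj z)" for w
  have Nz: "N z = 0" using nz[of z] z by (simp add: N_def)
  have "N holomorphic_on {w. 0 \<le> Im w}"
    unfolding N_def using nz holo by (auto intro!: holomorphic_intros)
  then have Qh: "Q holomorphic_on {w. 0 \<le> Im w}"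
    unfolding Q_def using interior_closed_upper_half_plane[OF z] by (rule pole_lemma)
  have Ph: "P holomorphic_on {w. 0 \<le> Im w}"
    unfolding P_def using nz holo by (auto intro!: holomorphic_intros)
  have div_le: "cmod (a / d) \<le> 2 * B / cmod w"
    if "cmod a \<le> B" "cmod w / 2 \<le> cmod d" "0 < cmod w" for a d B w
  proof -
    have "0 \<le> B" using that(1) norm_ge_zero order_trans by blast
    then have "cmod a / cmod d \<le> B / (cmod w / 2)" using that by (intro frac_le) auto
    then show ?thesis by (simp add: norm_divide mult.commute)
  qed
  have P_le: "cmod (P w) \<le> 2 * C / (cmod w)\<^sup>2" if "0 \<le> Im w" "R \<le> cmod w" for w
    using div_le[OF le far(2,3)] that R unfolding P_def by (force simp: power2_eq_square)
  define D where "D = 2 * (C + 2 * cmod (G z * (z - cnj z)))"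
  have Q_le: "cmod (Q w) \<le> D / (cmod w)\<^sup>2" if w: "0 \<le> Im w" "R \<le> cmod w" for w
  proof -
    have "cmod (N w) \<le> cmod (G w) + cmod (G z * (z - cnj z) / (w - cnj z))"
      unfolding N_def by (rule norm_triangle_ineq4)
    also have "\<dots> \<le> C / cmod w + 2 * cmod (G z * (z - cnj z)) / cmod w"
      using w R far by (intro add_mono le div_le order_refl) auto
    finally have "cmod (N w) \<le> (C + 2 * cmod (G z * (z - cnj z))) / cmod w"
      by (simp add: add_divide_distrib)
    from div_le[OF this far(1,3)] w
    have "cmod (N w / (w - z)) \<le> D / (cmod w)\<^sup>2" by (simp add: D_def power2_eq_square)
    moreover have "w \<noteq> z" using far(1,3)[OF w(2)] by auto
    ultimately show ?thesis by (simp add: Q_def Nz)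
  qed
  note Pi = integral_real_line_eq_0[OF Ph R(2) P_le] and Qi = integral_real_line_eq_0[OF Qh R(2) Q_le]
  let ?k = "\<lambda>x. Im z / (cmod (complex_of_real x - z))\<^sup>2"
  \<comment> \<open>A function that is not integrable has integral 0 by convention, so the value
    \<open>pi\<close> already yields integrability.\<close>
  have ki: "integrable lborel ?k"
    using integral_poisson_kernel[OF z] not_integrable_integral_eq pi_neq_zero by metis
  \<comment> \<open>On the real line \<open>cnj (P x)\<close> is \<open>cnj (G x) / (x - z)\<close>,
    so \<open>Q - cnj P\<close> is \<open>2 * \<i> * Im G / (x - z)\<close> up to the Poisson term.
    After integration \<open>Q\<close> and \<open>P\<close> contribute nothing, and the Poisson term
    gives \<open>2 * \<i> * pi * G z\<close>.\<close>
  have eq: "2 * \<i> * pi * (complex_of_real (- Im (G (complex_of_real x)) / pi) / (z - complex_of_real x))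
     = Q x - cnj (P x) + 2 * \<i> * G z * complex_of_real (?k x)" for x
  proof -
    define g d where "g = G (complex_of_real x)" and "d = complex_of_real x - z"
    have d: "d \<noteq> 0" "cnj d \<noteq> 0" using z by (auto simp: d_def complex_eq_iff)
    have zx: "z - complex_of_real x = - d" "complex_of_real x - cnj z = cnj d"
      by (simp_all add: d_def)
    have k: "complex_of_real (?k x) = Im z / (d * cnj d)"
      unfolding d_def[symmetric] using complex_norm_square[of d] by simp
    have z2: "z - cnj z = 2 * \<i> * Im z" by (simp add: complex_eq_iff)
    have g2: "g - cnj g = 2 * \<i> * Im g" by (simp add: complex_eq_iff)
    have "Q x = (g - G z * (2 * \<i> * Im z) / cnj d) / d"
    proof -
      have "complex_of_real x \<noteq> z" using d(1) by (simp add: d_def)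
      then show ?thesis
        unfolding Q_def Nz by (simp add: N_def zx z2 g_def d_def[symmetric])
    qed
    moreover have "cnj (P x) = cnj g / d"
      by (simp add: P_def zx g_def)
    moreover have "2 * \<i> * pi * (complex_of_real (- Im g / pi) / (z - complex_of_real x)) = (2 * \<i> * Im g) / d"
      using d by (simp add: zx field_simps)
    moreover have "(g - G z * (2 * \<i> * Im z) / cnj d) / d - cnj g / d
        + 2 * \<i> * G z * (Im z / (d * cnj d)) = (g - cnj g) / d"
      using d by (simp add: divide_simps) (simp add: algebra_simps)
    ultimately show ?thesis
      unfolding k g_def[symmetric] g2 by presburger
  qed
  let ?I = "\<integral>x. complex_of_real (- Im (G (complex_of_real x)) / pi) / (z - complex_of_real x) \<partial>lborel"
  have "(2 * \<i> * pi) * ?I = (\<integral>x. Q x - cnj (P x) + 2 * \<i> * G z * complex_of_real (?k x) \<partial>lborel)"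
    unfolding eq[symmetric] by (rule integral_mult_right_zero[symmetric])
  also have "\<dots> = 2 * \<i> * G z * pi"
    using Pi Qi ki integral_poisson_kernel[OF z] by (simp del: of_real_divide of_real_power)
  finally have "(2 * \<i> * pi) * ?I = (2 * \<i> * pi) * G z" by (simp only: mult_ac)
  then show "?I = G z" by (subst (asm) mult_cancel_left) simp
qed

text \<open>Put \<open>F w = w - m + h w\<close> and \<open>G = 1 / F\<close>. Positivity of
  \<open>Im h\<close> up to the real axis keeps \<open>F\<close> free of zeros, so Stieltjes
  inversion gives \<open>G\<close> the density \<open>- Im G / pi = Im F / (pi * |F|^2)\<close>,
  which is nonnegative. Its mass is the limit of \<open>w * G w\<close> up the imaginary axis,
  namely 1.\<close>

lemma ex_measure_F_transform:
  fixes h :: "complex \<Rightarrow> complex" and m K :: real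
  assumes holo: "h holomorphic_on {w. 0 \<le> Im w}"
    and pos: "\<And>w. 0 \<le> Im w \<Longrightarrow> 0 < Im (h w)"
    and bound: "\<And>w. 0 \<le> Im w \<Longrightarrow> cmod (h w) \<le> K"
  shows "\<exists>\<nu>. real_prob_measure \<nu> \<and> (\<forall>z\<in>upper_half. F_transform \<nu> z = z - complex_of_real m + h z)"
proof -
  define F where "F w = w - complex_of_real m + h w" for w
  define G where "G w = 1 / F w" for w
  define f where "f x = - Im (G (complex_of_real x)) / pi" for x
  \<comment> \<open>For \<open>cmod w \<ge> R\<close> the perturbation \<open>|m| + K\<close> is at
    most \<open>cmod w / 2\<close>, whence \<open>|F w| \<ge> |w| / 2\<close>.\<close>
  define R where "R = 2 * (\<bar>m\<bar> + K) + 1"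
  have K0: "0 \<le> K" using order_trans[OF norm_ge_zero bound[of 0]] by simp
  have R0: "0 < R" using K0 by (simp add: R_def)
  have ImF: "0 < Im (F w)" if "0 \<le> Im w" for w using pos[OF that] that by (simp add: F_def)
  then have nz: "F w \<noteq> 0" if "0 \<le> Im w" for w using that by fastforce
  have F_ge: "cmod w / 2 \<le> cmod (F w)" if "0 \<le> Im w" "R \<le> cmod w" for w
  proof -
    have "cmod w \<le> cmod (F w) + \<bar>m\<bar> + cmod (h w)"
      using norm_triangle_ineq4[of "F w + complex_of_real m" "h w"] norm_triangle_ineq[of "F w" "complex_of_real m"]
      by (simp add: F_def)
    moreover have "\<bar>m\<bar> + K \<le> cmod w / 2" using that(2) by (simp add: R_def field_simps)
    ultimately show ?thesis using bound[OF that(1)] by simp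
  qed
  have Gh: "G holomorphic_on {w. 0 \<le> Im w}"
    unfolding G_def using nz holo unfolding F_def by (auto intro!: holomorphic_intros)
  have G_le: "cmod (G w) \<le> 2 / cmod w" if "0 \<le> Im w" "R \<le> cmod w" for w
  proof -
    have "1 / cmod (F w) \<le> 1 / (cmod w / 2)" using F_ge[OF that] R0 that by (intro frac_le) auto
    then show ?thesis by (simp add: G_def norm_divide)
  qed
  have f_eq: "f x = Im (F x) / ((cmod (F x))\<^sup>2 * pi)" for x
    by (simp add: f_def G_def Im_divide cmod_power2)
  have f_nonneg: "0 \<le> f x" for x
    unfolding f_eq using ImF[of "complex_of_real x"] by (auto intro!: divide_nonneg_nonneg)
  have "continuous_on UNIV (\<lambda>x. G (complex_of_real x))"
    by (rule continuous_on_compose2[OF holomorphic_on_imp_continuous_on[OF Gh]]) (auto intro!: continuous_intros)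
  then have f_cont: "continuous_on UNIV f"
    unfolding f_def by (intro continuous_intros) auto
  \<comment> \<open>\<open>G\<close> is only known to decay like \<open>1 / |x|\<close>. Its
    imaginary part gains a power because \<open>x - m\<close> is real:
    \<open>Im (F x) = Im (h x) \<le> K\<close>, while \<open>|F x|^2\<close> grows
    quadratically.\<close>
  have f_int: "integrable lborel f"
  proof (rule integrable_lborel_quadratic_decay[OF f_cont R0])
    fix x :: real assume x: "R \<le> \<bar>x\<bar>"
    have "(\<bar>x\<bar> / 2)\<^sup>2 \<le> (cmod (F x))\<^sup>2"
      using F_ge[of "complex_of_real x"] x by (intro power_mono) auto
    then have "x\<^sup>2 / 4 \<le> (cmod (F x))\<^sup>2" by (simp add: power_divide)
    moreover have "Im (F x) \<le> K"
      using bound[of "complex_of_real x"] abs_Im_le_cmod[of "h x"] by (simp add: F_def)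
    ultimately have "f x \<le> K / (x\<^sup>2 / 4 * pi)"
      unfolding f_eq using R0 x K0 by (intro frac_le mult_right_mono) auto
    then show "norm (f x) \<le> (4 * K / pi) / x\<^sup>2"
      using f_nonneg[of x] by (simp add: field_simps)
  qed
  have inv: "(\<integral>x. complex_of_real (f x) / (z - complex_of_real x) \<partial>lborel) = G z" if "0 < Im z" for z
    unfolding f_def using Gh R0 G_le that by (rule stieltjes_inversion_upper_half_plane)
  have f_meas [measurable]: "f \<in> borel_measurable borel"
    using f_cont by (rule borel_measurable_continuous_onI)
  have mass: "(\<integral>x. f x \<partial>lborel) = 1"
  proof -
    \<comment> \<open>Points running up the imaginary axis; \<open>Suc n\<close> avoids the origin,
      since \<open>s n\<close> is used as a divisor.\<close>
    define s where "s n = \<i> * complex_of_real (real (Suc n))" for n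
    have s: "0 < Im (s n)" "s n \<noteq> 0" for n by (simp_all add: s_def complex_eq_iff)
    have "filterlim (\<lambda>n. real (Suc n)) at_top sequentially"
      by (rule filterlim_compose[OF filterlim_real_sequentially filterlim_Suc])
    then have s_lim: "filterlim s at_infinity sequentially"
      unfolding s_def filterlim_at_infinity_conv_norm_at_top
      by (simp add: norm_mult del: of_nat_Suc)
    have "(\<lambda>n. \<integral>x. s n * (complex_of_real (f x) / (s n - complex_of_real x)) \<partial>lborel)
       \<longlonglongrightarrow> (\<integral>x. complex_of_real (f x) \<partial>lborel)"
    proof (rule integral_dominated_convergence[where w = f])
      show "AE x in lborel. (\<lambda>n. s n * (complex_of_real (f x) / (s n - complex_of_real x))) \<longlonglongrightarrow> complex_of_real (f x)"
      proof (rule AE_I2)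
        fix x
        have "(\<lambda>n. complex_of_real (f x) / (1 - complex_of_real x / s n)) \<longlonglongrightarrow> complex_of_real (f x) / (1 - 0)"
          by (intro tendsto_intros tendsto_divide_0[OF tendsto_const s_lim]) auto
        moreover have "complex_of_real (f x) / (1 - complex_of_real x / s n) = s n * (complex_of_real (f x) / (s n - complex_of_real x))" for n
        proof -
          have "1 - complex_of_real x / s n = (s n - complex_of_real x) / s n"
            using s(2)[of n] by (simp add: field_simps)
          then show ?thesis by simp
        qed
        ultimately show "(\<lambda>n. s n * (complex_of_real (f x) / (s n - complex_of_real x))) \<longlonglongrightarrow> complex_of_real (f x)"
          by simp
      qed
      \<comment> \<open>The imaginary part of \<open>s n - x\<close> is \<open>cmod (s n)\<close>,
        so the factor multiplying \<open>f x\<close> has modulus at most 1 and \<open>f\<close>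
        itself dominates.\<close>
      show "AE x in lborel. cmod (s n * (complex_of_real (f x) / (s n - complex_of_real x))) \<le> f x" for n
      proof (rule AE_I2)
        fix x
        have "cmod (s n) \<le> cmod (s n - complex_of_real x)"
          using abs_Im_le_cmod[of "s n - complex_of_real x"] by (simp add: s_def norm_mult del: of_nat_Suc)
        then have "f x * cmod (s n) \<le> f x * cmod (s n - complex_of_real x)"
          using f_nonneg by (intro mult_left_mono)
        then show "cmod (s n * (complex_of_real (f x) / (s n - complex_of_real x))) \<le> f x"
          using f_nonneg[of x] by (cases "s n = complex_of_real x") (auto simp: norm_mult norm_divide divide_simps mult.commute)
      qed
    qed (use f_int in \<open>auto intro!: borel_measurable_times borel_measurable_divide\<close>)
    then have "(\<lambda>n. s n * G (s n)) \<longlonglongrightarrow> complex_of_real (\<integral>x. f x \<partial>lborel)"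
      unfolding integral_mult_right_zero inv[OF s(1)] integral_complex_of_real .
    moreover have "(\<lambda>n. s n * G (s n)) \<longlonglongrightarrow> 1"
    proof -
      have "(\<lambda>n. (h (s n) - complex_of_real m) / s n) \<longlonglongrightarrow> 0"
      proof (rule Lim_null_comparison)
        show "\<forall>\<^sub>F n in sequentially. cmod ((h (s n) - complex_of_real m) / s n) \<le> (K + \<bar>m\<bar>) / cmod (s n)"
        proof (rule always_eventually, rule allI)
          fix n
          have "cmod (h (s n) - complex_of_real m) \<le> K + \<bar>m\<bar>"
            using norm_triangle_ineq4[of "h (s n)" "complex_of_real m"] bound[of "s n"] s(1)[of n] by simp
          then show "cmod ((h (s n) - complex_of_real m) / s n) \<le> (K + \<bar>m\<bar>) / cmod (s n)"
            by (simp add: norm_divide divide_right_mono)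
        qed
        show "(\<lambda>n. (K + \<bar>m\<bar>) / cmod (s n)) \<longlonglongrightarrow> 0"
          using s_lim unfolding filterlim_at_infinity_conv_norm_at_top
          by (intro tendsto_divide_0[OF tendsto_const] filterlim_at_top_imp_at_infinity)
      qed
      then have "(\<lambda>n. 1 / (1 + (h (s n) - complex_of_real m) / s n)) \<longlonglongrightarrow> 1 / (1 + 0)"
        by (intro tendsto_intros) auto
      moreover have "1 / (1 + (h (s n) - complex_of_real m) / s n) = s n * G (s n)" for n
      proof -
        have "1 + (h (s n) - complex_of_real m) / s n = F (s n) / s n"
          using s(2)[of n] by (simp add: F_def field_simps)
        then show ?thesis by (simp add: G_def)
      qed
      ultimately show ?thesis by simp
    qed
    ultimately show ?thesis
      using LIMSEQ_unique of_real_eq_1_iff by blast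
  qed
  define \<nu> where "\<nu> = density lborel (\<lambda>x. ennreal (f x))"
  have "prob_space \<nu>"
  proof
    have "emeasure \<nu> (space \<nu>) = (\<integral>\<^sup>+ x. ennreal (f x) \<partial>lborel)"
      by (simp add: \<nu>_def emeasure_density)
    also have "\<dots> = 1" using f_int f_nonneg mass by (subst nn_integral_eq_integral) auto
    finally show "emeasure \<nu> (space \<nu>) = 1" .
  qed
  moreover have "sets \<nu> = sets borel" by (simp add: \<nu>_def)
  moreover have "F_transform \<nu> z = F z" if "z \<in> upper_half" for z
  proof -
    have z: "0 < Im z" using that by (simp add: upper_half_def)
    have "cauchy_transform \<nu> z = (\<integral>x. f x *\<^sub>R (1 / (z - complex_of_real x)) \<partial>lborel)"
      unfolding cauchy_transform_def \<nu>_def using f_nonneg by (intro integral_density) auto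
    also have "\<dots> = G z" using inv[OF z] by (simp add: scaleR_conv_of_real)
    finally show ?thesis by (simp add: F_transform_def G_def)
  qed
  ultimately show ?thesis unfolding real_prob_measure_def F_def by blast
qed

subsection \<open>The reciprocal Cauchy transform of a measure of finite variance\<close>

text \<open>The product carries no conjugate, as suits the covariances of resolvents below.
  Integrating \<open>(t * |A| - |B|)^2\<close> gives a polynomial in \<open>t\<close> that is
  nowhere negative.\<close>

lemma Cauchy_Schwarz_complex_integral:
  fixes A B :: "'a \<Rightarrow> complex"
  assumes [measurable]: "A \<in> borel_measurable M" "B \<in> borel_measurable M"
    and A: "integrable M (\<lambda>x. (cmod (A x))\<^sup>2)" and B: "integrable M (\<lambda>x. (cmod (B x))\<^sup>2)"
  shows "integrable M (\<lambda>x. A x * B x)"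
    and "(cmod (\<integral>x. A x * B x \<partial>M))\<^sup>2 \<le> (\<integral>x. (cmod (A x))\<^sup>2 \<partial>M) * (\<integral>x. (cmod (B x))\<^sup>2 \<partial>M)"
proof -
  have le: "cmod (A x * B x) \<le> (cmod (A x))\<^sup>2 + (cmod (B x))\<^sup>2" for x
  proof -
    have "0 \<le> (cmod (A x) - cmod (B x))\<^sup>2" by simp
    then have "2 * (cmod (A x) * cmod (B x)) \<le> (cmod (A x))\<^sup>2 + (cmod (B x))\<^sup>2"
      by (simp add: power2_eq_square algebra_simps)
    moreover have "0 \<le> cmod (A x) * cmod (B x)" by simp
    ultimately show ?thesis unfolding norm_mult by linarith
  qed
  show AB: "integrable M (\<lambda>x. A x * B x)"
    by (rule Bochner_Integration.integrable_bound[OF Bochner_Integration.integrable_add[OF A B]])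
       (use le in \<open>auto intro!: AE_I2\<close>)
  define p q N where "p = (\<integral>x. (cmod (A x))\<^sup>2 \<partial>M)" and "q = (\<integral>x. (cmod (B x))\<^sup>2 \<partial>M)"
    and "N = (\<integral>x. cmod (A x * B x) \<partial>M)"
  have N: "integrable M (\<lambda>x. cmod (A x * B x))" using AB by simp
  have N0: "0 \<le> N" unfolding N_def by (rule Bochner_Integration.integral_nonneg) simp
  have pq: "0 \<le> p" "0 \<le> q" unfolding p_def q_def by (auto intro!: Bochner_Integration.integral_nonneg)
  have quad: "0 \<le> t\<^sup>2 * p - 2 * t * N + q" for t
  proof -
    have "0 \<le> (\<integral>x. (t * cmod (A x) - cmod (B x))\<^sup>2 \<partial>M)"
      by (rule Bochner_Integration.integral_nonneg) simp
    also have "(\<lambda>x. (t * cmod (A x) - cmod (B x))\<^sup>2) =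
       (\<lambda>x. t\<^sup>2 * (cmod (A x))\<^sup>2 - 2 * t * cmod (A x * B x) + (cmod (B x))\<^sup>2)"
      by (auto simp: power2_eq_square algebra_simps norm_mult)
    also have "(\<integral>x. t\<^sup>2 * (cmod (A x))\<^sup>2 - 2 * t * cmod (A x * B x) + (cmod (B x))\<^sup>2 \<partial>M)
       = t\<^sup>2 * p - 2 * t * N + q"
      unfolding p_def q_def N_def
      by (subst Bochner_Integration.integral_add Bochner_Integration.integral_diff
           | intro Bochner_Integration.integrable_diff integrable_mult_right A B N | simp)+
    finally show ?thesis .
  qed
  have "N\<^sup>2 \<le> p * q"
  \<comment> \<open>For \<open>p = 0\<close> the polynomial is \<open>q - 2 * t * N\<close>, and for
    \<open>N \<noteq> 0\<close> the chosen \<open>t\<close> gives it the value -1. Otherwise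
    \<open>t = N / p\<close> is its minimum point.\<close>
  proof (cases "p = 0")
    case True
    have "N = 0"
    proof (rule ccontr)
      assume "N \<noteq> 0"
      with quad[of "(q + 1) / (2 * N)"] True show False by simp
    qed
    then show ?thesis using True by simp
  next
    case False
    with quad[of "N / p"] pq show ?thesis
      by (simp add: power2_eq_square field_simps)
  qed
  moreover have "cmod (\<integral>x. A x * B x \<partial>M) \<le> N"
    unfolding N_def by (rule integral_norm_bound)
  ultimately show "(cmod (\<integral>x. A x * B x \<partial>M))\<^sup>2 \<le> (\<integral>x. (cmod (A x))\<^sup>2 \<partial>M) * (\<integral>x. (cmod (B x))\<^sup>2 \<partial>M)"
    unfolding p_def q_def by (meson norm_ge_zero order_trans power_mono)
qed

section \<open>Resolvents, the Cauchy transform and the remainder term\<close>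

context real_distribution
begin

definition resolvent :: "complex \<Rightarrow> real \<Rightarrow> complex" where
  "resolvent w x = 1 / (w - complex_of_real x)"

lemma cauchy_transform_eq: "cauchy_transform M w = expectation (resolvent w)"
  by (simp add: cauchy_transform_def resolvent_def[abs_def])

lemma prob_UNIV_eq_1: "prob UNIV = 1"
  using prob_space by simp

lemma resolvent_denom_nonzero: "0 < Im w \<Longrightarrow> w - complex_of_real x \<noteq> 0"
  by (auto simp: complex_eq_iff)

lemma norm_resolvent_le: "0 < Im w \<Longrightarrow> cmod (resolvent w x) \<le> 1 / Im w"
  using abs_Im_le_cmod[of "w - complex_of_real x"] resolvent_denom_nonzero[of w x]
  by (simp add: norm_divide divide_simps resolvent_def)

lemma measurable_resolvent [measurable]: "resolvent w \<in> borel_measurable M"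
  unfolding resolvent_def by measurable

lemma integrable_resolvent: "0 < Im w \<Longrightarrow> integrable M (resolvent w)"
  by (rule integrable_const_bound[where B = "1 / Im w"]) (auto intro!: AE_I2 norm_resolvent_le)

text \<open>The shift \<open>c\<close> is 0 for second moments and
  \<open>cauchy_transform M w\<close> for variances.\<close>

lemma integrable_norm_resolvent_sq:
  assumes "0 < Im w" shows "integrable M (\<lambda>x. (cmod (resolvent w x - c))\<^sup>2)"
proof (rule integrable_const_bound[where B = "(1 / Im w + cmod c)\<^sup>2"])
  have "cmod (resolvent w x - c) \<le> 1 / Im w + cmod c" for x
    using norm_triangle_ineq4[of "resolvent w x" c] norm_resolvent_le[OF assms, of x] by linarith
  then show "AE x in M. norm ((cmod (resolvent w x - c))\<^sup>2) \<le> (1 / Im w + cmod c)\<^sup>2"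
    by (auto intro!: AE_I2 power_mono)
qed measurable

lemma Im_resolvent: "0 < Im w \<Longrightarrow> Im (resolvent w x) = - Im w * (cmod (resolvent w x))\<^sup>2"
  by (simp add: Im_divide norm_divide power_divide cmod_power2 resolvent_def)

lemma Im_cauchy_transform:
  assumes "0 < Im w"
  shows "Im (cauchy_transform M w) = - Im w * (\<integral>x. (cmod (resolvent w x))\<^sup>2 \<partial>M)"
proof -
  have "Im (cauchy_transform M w) = (\<integral>x. Im (resolvent w x) \<partial>M)"
    unfolding cauchy_transform_eq using integral_Im[OF integrable_resolvent[OF assms]] by simp
  also have "\<dots> = (\<integral>x. - Im w * (cmod (resolvent w x))\<^sup>2 \<partial>M)"
    by (intro Bochner_Integration.integral_cong refl Im_resolvent assms)
  finally show ?thesis by simp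
qed

lemma cauchy_transform_nonzero:
  assumes "0 < Im w" shows "cauchy_transform M w \<noteq> 0"
proof -
  have "Im (resolvent w x) < 0" for x
    using resolvent_denom_nonzero[OF assms, of x] assms
    by (subst Im_resolvent) (auto intro!: mult_pos_pos simp: resolvent_def)
  then have "(\<integral>x. Im (resolvent w x) \<partial>M) < 0"
    by (intro expectation_less integrable_Im integrable_resolvent assms AE_I2)
  then show ?thesis
    unfolding cauchy_transform_eq using integral_Im[OF integrable_resolvent[OF assms]] by force
qed

lemma resolvent_identity:
  "0 < Im w \<Longrightarrow> 0 < Im z \<Longrightarrow> resolvent z x - resolvent w x = (w - z) * (resolvent w x * resolvent z x)"
  using resolvent_denom_nonzero[of w x] resolvent_denom_nonzero[of z x]
  by (simp add: resolvent_def divide_simps)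

lemma integrable_resolvent_mult:
  assumes "0 < Im w" "0 < Im z" shows "integrable M (\<lambda>x. resolvent w x * resolvent z x)"
  by (rule Cauchy_Schwarz_complex_integral(1))
     (use integrable_norm_resolvent_sq[of _ 0] assms in \<open>simp_all\<close>)

lemma cauchy_transform_diff:
  assumes "0 < Im w" "0 < Im z"
  shows "cauchy_transform M z - cauchy_transform M w
    = (w - z) * (\<integral>x. resolvent w x * resolvent z x \<partial>M)"
proof -
  have "cauchy_transform M z - cauchy_transform M w = (\<integral>x. resolvent z x - resolvent w x \<partial>M)"
    unfolding cauchy_transform_eq
    by (intro Bochner_Integration.integral_diff[symmetric] integrable_resolvent assms)
  then show ?thesis by (simp add: resolvent_identity assms)
qed

text \<open>By the resolvent identity the difference quotient is exactly minus the integral of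
  \<open>resolvent w x * resolvent z x\<close>. What remains is continuity of this integral in
  \<open>z\<close> at \<open>w\<close>, which follows from a Lipschitz estimate.\<close>

lemma cauchy_transform_has_field_derivative:
  assumes w: "0 < Im w"
  shows "(cauchy_transform M has_field_derivative - (\<integral>x. (resolvent w x)\<^sup>2 \<partial>M)) (at w)"
proof -
  let ?I = "\<lambda>z. \<integral>x. resolvent w x * resolvent z x \<partial>M"
  \<comment> \<open>A bound for a product of three resolvents: two at \<open>w\<close>, each at most
    \<open>1 / Im w\<close>, and one at \<open>z\<close>, at most \<open>2 / Im w\<close> once
    \<open>Im z \<ge> Im w / 2\<close>.\<close>
  define K where "K = 2 / Im w ^ 3"
  have bound: "cmod (- ?I z - - ?I w) \<le> K * cmod (z - w)" if "cmod (z - w) < Im w / 2" for z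
  proof -
    have z2: "Im w / 2 \<le> Im z" using that abs_Im_le_cmod[of "z - w"] by simp
    with w have z: "0 < Im z" by linarith
    have "- ?I z - - ?I w = (\<integral>x. resolvent w x * resolvent w x - resolvent w x * resolvent z x \<partial>M)"
      by (simp add: integrable_resolvent_mult w z)
    also have "\<dots> = (\<integral>x. (z - w) * (resolvent w x * (resolvent w x * resolvent z x)) \<partial>M)"
    proof (intro Bochner_Integration.integral_cong refl)
      fix x
      show "resolvent w x * resolvent w x - resolvent w x * resolvent z x
          = (z - w) * (resolvent w x * (resolvent w x * resolvent z x))"
        using resolvent_identity[OF w z, of x] by algebra
    qed
    finally have "cmod (- ?I z - - ?I w) = cmod (z - w) * cmod (\<integral>x. resolvent w x * (resolvent w x * resolvent z x) \<partial>M)"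
      by (simp add: norm_mult)
    moreover have "cmod (resolvent w x * (resolvent w x * resolvent z x)) \<le> K" for x
    proof -
      have "cmod (resolvent z x) \<le> 2 / Im w"
      proof -
        have "1 / Im z \<le> 1 / (Im w / 2)" using z2 w z by (intro divide_left_mono) auto
        then show ?thesis using norm_resolvent_le[OF z, of x] by simp
      qed
      then have "cmod (resolvent w x * (resolvent w x * resolvent z x)) \<le> 1 / Im w * (1 / Im w * (2 / Im w))"
        unfolding norm_mult using norm_resolvent_le[OF w, of x] w
        by (intro mult_mono) auto
      then show ?thesis by (simp add: K_def power3_eq_cube)
    qed
    then have "(\<integral>x. cmod (resolvent w x * (resolvent w x * resolvent z x)) \<partial>M) \<le> K"
      by (intro integral_le_const integrable_const_bound[where B = K] AE_I2) auto
    then have "cmod (\<integral>x. resolvent w x * (resolvent w x * resolvent z x) \<partial>M) \<le> K"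
      by (rule order_trans[OF integral_norm_bound])
    then have "cmod (z - w) * cmod (\<integral>x. resolvent w x * (resolvent w x * resolvent z x) \<partial>M) \<le> cmod (z - w) * K"
      by (rule mult_left_mono) simp
    ultimately show ?thesis by (simp only: mult.commute[of K])
  qed
  have ev: "\<forall>\<^sub>F z in at w. cmod (z - w) < Im w / 2"
    using w eventually_at[of "\<lambda>z. cmod (z - w) < Im w / 2" w UNIV] by (auto simp: dist_norm intro!: exI[of _ "Im w / 2"])
  have "((\<lambda>z. - ?I z - - ?I w) \<longlongrightarrow> 0) (at w)"
  proof (rule Lim_null_comparison)
    show "\<forall>\<^sub>F z in at w. cmod (- ?I z - - ?I w) \<le> K * cmod (z - w)"
      using ev by eventually_elim (rule bound)
    show "((\<lambda>z. K * cmod (z - w)) \<longlongrightarrow> 0) (at w)"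
      by (auto intro!: tendsto_eq_intros)
  qed
  then have "((\<lambda>z. - ?I z) \<longlongrightarrow> - ?I w) (at w)" by (rule LIM_zero_cancel)
  moreover have "\<forall>\<^sub>F z in at w. - ?I z = (cauchy_transform M z - cauchy_transform M w) / (z - w)"
  proof -
    have "\<forall>\<^sub>F z in at w. z \<noteq> w" by (simp add: eventually_at_filter)
    with ev show ?thesis
    proof eventually_elim
      case (elim z)
      then have "0 < Im z" using w abs_Im_le_cmod[of "z - w"] by simp
      with elim show ?case by (simp add: cauchy_transform_diff w field_simps)
    qed
  qed
  ultimately have "((\<lambda>z. (cauchy_transform M z - cauchy_transform M w) / (z - w)) \<longlongrightarrow> - ?I w) (at w)"
    by (rule Lim_transform_eventually)
  then show ?thesis by (simp add: has_field_derivative_iff power2_eq_square)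
qed

lemma F_transform_holomorphic: "F_transform M holomorphic_on upper_half"
proof -
  have "cauchy_transform M holomorphic_on upper_half"
    unfolding holomorphic_on_def field_differentiable_def upper_half_def
    using cauchy_transform_has_field_derivative has_field_derivative_at_within by blast
  then show ?thesis
    unfolding F_transform_def[abs_def]
    by (intro holomorphic_intros) (auto simp: upper_half_def cauchy_transform_nonzero)
qed

lemma integral_resolvent_covariance:
  assumes "0 < Im w" "0 < Im z"
  shows "(\<integral>x. (resolvent w x - cauchy_transform M w) * (resolvent z x - cauchy_transform M z) \<partial>M)
    = (\<integral>x. resolvent w x * resolvent z x \<partial>M) - cauchy_transform M w * cauchy_transform M z"
proof -
  have "(\<integral>x. (resolvent w x - cauchy_transform M w) * (resolvent z x - cauchy_transform M z) \<partial>M)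
    = (\<integral>x. resolvent w x * resolvent z x - cauchy_transform M w * resolvent z x
          - cauchy_transform M z * resolvent w x + cauchy_transform M w * cauchy_transform M z \<partial>M)"
    by (intro Bochner_Integration.integral_cong refl) (simp add: algebra_simps)
  also have "\<dots> = (\<integral>x. resolvent w x * resolvent z x \<partial>M) - cauchy_transform M w * cauchy_transform M z
          - cauchy_transform M z * cauchy_transform M w + cauchy_transform M w * cauchy_transform M z"
    unfolding cauchy_transform_eq
    by (simp add: integrable_resolvent_mult integrable_resolvent assms prob_UNIV_eq_1)
  finally show ?thesis by simp
qed

lemma integral_resolvent_variance:
  assumes "0 < Im w"
  shows "(\<integral>x. (cmod (resolvent w x - cauchy_transform M w))\<^sup>2 \<partial>M)
    = (\<integral>x. (cmod (resolvent w x))\<^sup>2 \<partial>M) - (cmod (cauchy_transform M w))\<^sup>2"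
proof -
  let ?G = "cauchy_transform M w"
  note i = integrable_resolvent[OF assms]
  have G: "(\<integral>x. Re (resolvent w x) \<partial>M) = Re ?G" "(\<integral>x. Im (resolvent w x) \<partial>M) = Im ?G"
    using integral_Re[OF i] integral_Im[OF i] by (auto simp: cauchy_transform_eq)
  have sq: "integrable M (\<lambda>x. (cmod (resolvent w x))\<^sup>2)"
    using integrable_norm_resolvent_sq[OF assms, of 0] by simp
  have "(\<integral>x. (cmod (resolvent w x - ?G))\<^sup>2 \<partial>M) = (\<integral>x. (cmod (resolvent w x))\<^sup>2
     - 2 * Re ?G * Re (resolvent w x) - 2 * Im ?G * Im (resolvent w x) + (cmod ?G)\<^sup>2 \<partial>M)"
    unfolding cmod_power2
    by (intro Bochner_Integration.integral_cong refl) (simp add: power2_eq_square algebra_simps)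
  also have "\<dots> = (\<integral>x. (cmod (resolvent w x))\<^sup>2 \<partial>M)
     - 2 * Re ?G * (\<integral>x. Re (resolvent w x) \<partial>M) - 2 * Im ?G * (\<integral>x. Im (resolvent w x) \<partial>M) + (cmod ?G)\<^sup>2"
    using integrable_Re[OF i] integrable_Im[OF i] sq by (simp add: prob_UNIV_eq_1 del: integral_Re integral_Im)
  also have "\<dots> = (\<integral>x. (cmod (resolvent w x))\<^sup>2 \<partial>M) - (cmod ?G)\<^sup>2"
    unfolding G cmod_power2 by (simp add: power2_eq_square)
  finally show ?thesis .
qed

text \<open>This is \<open>H\<close>. For finite variance it is classically minus the Cauchy
  transform of a positive measure whose mass is the variance. The mean enters as a real constant,
  which drops out of imaginary parts and of differences.\<close>

definition F_remainder :: "complex \<Rightarrow> complex" where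
  "F_remainder w = F_transform M w - w + complex_of_real (\<integral>x. x \<partial>M)"

text \<open>Since \<open>Im (1 / G) = - Im G / |G|^2\<close>, subtracting \<open>Im w\<close> turns
  the second moment of the resolvent into its variance, which exhibits the sign.\<close>

lemma Im_F_remainder:
  assumes "0 < Im w"
  shows "Im (F_remainder w)
    = Im w * (\<integral>x. (cmod (resolvent w x - cauchy_transform M w))\<^sup>2 \<partial>M) / (cmod (cauchy_transform M w))\<^sup>2"
proof -
  let ?G = "cauchy_transform M w"
  have nz: "(cmod ?G)\<^sup>2 \<noteq> 0" using cauchy_transform_nonzero[OF assms] by simp
  have "Im (F_remainder w) = - Im ?G / (cmod ?G)\<^sup>2 - Im w"
    by (simp add: F_remainder_def F_transform_def Im_divide cmod_power2)
  then show ?thesis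
    using nz unfolding integral_resolvent_variance[OF assms] Im_cauchy_transform[OF assms]
    by (simp add: field_simps)
qed

lemma Im_F_remainder_nonneg: "0 < Im w \<Longrightarrow> 0 \<le> Im (F_remainder w)"
  by (subst Im_F_remainder) (auto intro!: mult_nonneg_nonneg divide_nonneg_nonneg Bochner_Integration.integral_nonneg)

text \<open>This is the Schwarz-Pick inequality for the half plane. The difference equals
  \<open>(w - z) * c / (?G * ?K)\<close> with \<open>c\<close> the covariance of the two resolvents,
  and Cauchy-Schwarz bounds \<open>c\<close> by their variances, which \<open>Im_F_remainder\<close>
  expresses through \<open>Im H\<close>.\<close>

lemma F_remainder_diff:
  assumes w: "0 < Im w" and z: "0 < Im z"
  shows "(cmod (F_remainder w - F_remainder z))\<^sup>2 * (Im w * Im z)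
    \<le> (cmod (w - z))\<^sup>2 * (Im (F_remainder w) * Im (F_remainder z))"
proof -
  let ?G = "cauchy_transform M w" and ?K = "cauchy_transform M z"
  define c where "c = (\<integral>x. (resolvent w x - ?G) * (resolvent z x - ?K) \<partial>M)"
  define p where "p = (\<integral>x. (cmod (resolvent w x - ?G))\<^sup>2 \<partial>M)"
  define q where "q = (\<integral>x. (cmod (resolvent z x - ?K))\<^sup>2 \<partial>M)"
  have nz: "?G \<noteq> 0" "?K \<noteq> 0" using cauchy_transform_nonzero[OF w] cauchy_transform_nonzero[OF z] by auto
  have "(w - z) * c = ?K - ?G - (w - z) * (?G * ?K)"
    unfolding c_def integral_resolvent_covariance[OF assms] cauchy_transform_diff[OF assms]
    by (simp add: algebra_simps)
  then have "?K - ?G = (w - z) * (c + ?G * ?K)" by (simp add: algebra_simps)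
  moreover have "F_remainder w - F_remainder z = (?K - ?G) / (?G * ?K) - (w - z)"
    using nz by (simp add: F_remainder_def F_transform_def field_simps)
  ultimately have "F_remainder w - F_remainder z = (w - z) * (c + ?G * ?K) / (?G * ?K) - (w - z)"
    by simp
  then have "F_remainder w - F_remainder z = (w - z) * c / (?G * ?K)"
    using nz by (simp add: distrib_left add_divide_distrib)
  then have "(cmod (F_remainder w - F_remainder z))\<^sup>2 = (cmod (w - z))\<^sup>2 * (cmod c)\<^sup>2 / ((cmod ?G)\<^sup>2 * (cmod ?K)\<^sup>2)"
    by (simp add: norm_mult norm_divide power_mult_distrib power_divide)
  also have "\<dots> \<le> (cmod (w - z))\<^sup>2 * (p * q) / ((cmod ?G)\<^sup>2 * (cmod ?K)\<^sup>2)"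
    unfolding c_def p_def q_def
    by (intro divide_right_mono mult_left_mono Cauchy_Schwarz_complex_integral integrable_norm_resolvent_sq assms)
       (auto intro!: mult_nonneg_nonneg)
  finally have "(cmod (F_remainder w - F_remainder z))\<^sup>2 * (Im w * Im z)
     \<le> (cmod (w - z))\<^sup>2 * (p * q) / ((cmod ?G)\<^sup>2 * (cmod ?K)\<^sup>2) * (Im w * Im z)"
    using assms by (intro mult_right_mono) auto
  then show ?thesis
    unfolding Im_F_remainder[OF w] Im_F_remainder[OF z] p_def[symmetric] q_def[symmetric]
    by (simp add: field_simps)
qed

text \<open>Now \<open>x\<close> replaces the second resolvent: \<open>H = - c / G\<close> with
  \<open>c\<close> the covariance of \<open>x\<close> and \<open>resolvent w x\<close>, again
  bounded by Cauchy-Schwarz.\<close>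

lemma F_remainder_bound_sq:
  assumes w: "0 < Im w" and int: "integrable M (\<lambda>x. x\<^sup>2)"
  shows "(cmod (F_remainder w))\<^sup>2 * Im w \<le> variance (\<lambda>x. x) * Im (F_remainder w)"
proof -
  let ?G = "cauchy_transform M w"
  define m where "m = (\<integral>x. x \<partial>M)"
  define p where "p = (\<integral>x. (cmod (resolvent w x - ?G))\<^sup>2 \<partial>M)"
  define c where "c = (\<integral>x. complex_of_real (x - m) * (resolvent w x - ?G) \<partial>M)"
  have X: "integrable M (\<lambda>x. x)"
    by (rule square_integrable_imp_integrable[OF _ int]) measurable
  have V: "integrable M (\<lambda>x. (cmod (complex_of_real (x - m)))\<^sup>2)"
    unfolding norm_of_real power2_abs using int X by (simp add: power2_diff)
  note CS = Cauchy_Schwarz_complex_integral[OF _ _ V integrable_norm_resolvent_sq[OF w, of ?G]]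
  have nz: "?G \<noteq> 0" using w by (rule cauchy_transform_nonzero)
  \<comment> \<open>From \<open>x * resolvent w x = w * resolvent w x - 1\<close>; integration then
    yields \<open>c = (w - m) * G - 1\<close>.\<close>
  have "c = (\<integral>x. (w - m) * resolvent w x - 1 - ?G * complex_of_real (x - m) \<partial>M)"
    unfolding c_def using resolvent_denom_nonzero[OF w]
    by (intro Bochner_Integration.integral_cong refl) (simp add: resolvent_def field_simps)
  also have "\<dots> = (w - m) * ?G - 1 - ?G * complex_of_real (\<integral>x. x - m \<partial>M)"
    using integrable_resolvent[OF w] X unfolding cauchy_transform_eq integral_complex_of_real[symmetric]
    by (simp add: prob_UNIV_eq_1 del: integral_complex_of_real of_real_diff)
  also have "(\<integral>x. x - m \<partial>M) = 0"
    using X by (simp add: prob_UNIV_eq_1 m_def)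
  finally have "1 = (w - m) * ?G - c" by simp
  moreover have "F_remainder w = 1 / ?G - (w - m)"
    by (simp add: F_remainder_def F_transform_def m_def[symmetric])
  ultimately have "F_remainder w = - c / ?G"
    using nz by (simp add: divide_simps) algebra
  then have "(cmod (F_remainder w))\<^sup>2 = (cmod c)\<^sup>2 / (cmod ?G)\<^sup>2"
    by (simp add: norm_divide power_divide)
  also have "\<dots> \<le> (\<integral>x. (cmod (complex_of_real (x - m)))\<^sup>2 \<partial>M) * p / (cmod ?G)\<^sup>2"
    unfolding c_def p_def by (intro divide_right_mono CS) auto
  finally have "(cmod (F_remainder w))\<^sup>2 * Im w
     \<le> (\<integral>x. (x - m)\<^sup>2 \<partial>M) * p / (cmod ?G)\<^sup>2 * Im w"
    using w by (intro mult_right_mono) (auto simp del: of_real_diff)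
  then show ?thesis
    unfolding Im_F_remainder[OF w] p_def[symmetric] m_def[symmetric]
    by (simp add: field_simps)
qed

text \<open>Since \<open>Im H \<le> |H|\<close>, one factor \<open>|H|\<close> cancels from the
  squared bound.\<close>

lemma F_remainder_bound:
  assumes w: "0 < Im w" and int: "integrable M (\<lambda>x. x\<^sup>2)"
  shows "cmod (F_remainder w) * Im w \<le> variance (\<lambda>x. x)"
proof (cases "F_remainder w = 0")
  case False
  have "(cmod (F_remainder w))\<^sup>2 * Im w \<le> variance (\<lambda>x. x) * cmod (F_remainder w)"
    using F_remainder_bound_sq[OF assms] abs_Im_le_cmod[of "F_remainder w"]
    by (smt (verit) Bochner_Integration.integral_nonneg mult_left_mono zero_le_power2)
  then show ?thesis using False by (simp add: power2_eq_square)
qed (auto intro!: Bochner_Integration.integral_nonneg)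

end

context real_distribution
begin

lemma F_transform_eq: "F_transform M w = w - complex_of_real (\<integral>x. x \<partial>M) + F_remainder w"
  by (simp add: F_remainder_def)

text \<open>Multiplying the Schwarz-Pick bound by \<open>Im w * Im z\<close> pairs each
  \<open>Im H\<close> with its height, and each such product is at most the variance.\<close>

lemma F_remainder_lipschitz:
  assumes w: "0 < Im w" and z: "0 < Im z" and int: "integrable M (\<lambda>x. x\<^sup>2)"
  shows "cmod (F_remainder w - F_remainder z) * (Im w * Im z) \<le> variance (\<lambda>x. x) * cmod (w - z)"
proof (rule power2_le_imp_le)
  let ?V = "variance (\<lambda>x. x)"
  have V0: "0 \<le> ?V" by (rule Bochner_Integration.integral_nonneg) simp
  have le: "Im (F_remainder u) * Im u \<le> ?V" if u: "0 < Im u" for u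
  proof -
    have "Im (F_remainder u) * Im u \<le> cmod (F_remainder u) * Im u"
      using abs_Im_le_cmod[of "F_remainder u"] u by (intro mult_right_mono) auto
    then show ?thesis using F_remainder_bound[OF u int] by linarith
  qed
  have "(cmod (F_remainder w - F_remainder z) * (Im w * Im z))\<^sup>2
    = (cmod (F_remainder w - F_remainder z))\<^sup>2 * (Im w * Im z) * (Im w * Im z)"
    by (simp add: power2_eq_square)
  also have "\<dots> \<le> (cmod (w - z))\<^sup>2 * (Im (F_remainder w) * Im (F_remainder z)) * (Im w * Im z)"
    using F_remainder_diff[OF w z] w z by (intro mult_right_mono) auto
  also have "\<dots> = (cmod (w - z))\<^sup>2 * ((Im (F_remainder w) * Im w) * (Im (F_remainder z) * Im z))"
    by simp
  also have "\<dots> \<le> (cmod (w - z))\<^sup>2 * (?V * ?V)"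
    using le[OF w] le[OF z] V0 Im_F_remainder_nonneg[OF z] w z
    by (intro mult_left_mono mult_mono) auto
  finally show "(cmod (F_remainder w - F_remainder z) * (Im w * Im z))\<^sup>2 \<le> (?V * cmod (w - z))\<^sup>2"
    by (simp add: power_mult_distrib power2_eq_square mult_ac)
  show "0 \<le> ?V * cmod (w - z)" using V0 by simp
qed

section \<open>Inversion above height \<open>s\<close> and the transformed measure\<close>

context
  fixes s :: real
  assumes int: "integrable M (\<lambda>x. x\<^sup>2)" and s: "0 \<le> s" "variance (\<lambda>x. x) = s\<^sup>2"
begin

text \<open>Equal values would give \<open>H w - H z = z - w\<close>, but above height
  \<open>s\<close> the Lipschitz factor \<open>s^2 / (Im w * Im z)\<close> is less than 1.\<close>

lemma inj_on_F_transform: "inj_on (F_transform M) {w. s < Im w}"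
proof (rule inj_onI, rule ccontr)
  fix w z assume wz: "w \<in> {w. s < Im w}" "z \<in> {w. s < Im w}" and eq: "F_transform M w = F_transform M z"
    and ne: "w \<noteq> z"
  have "F_remainder w - F_remainder z = z - w"
    using eq by (simp add: F_transform_eq algebra_simps)
  then have "cmod (w - z) * (Im w * Im z) \<le> s\<^sup>2 * cmod (w - z)"
    using F_remainder_lipschitz[OF _ _ int, of w z] wz s by (simp add: norm_minus_commute)
  then have "Im w * Im z \<le> s * s" using ne by (simp add: mult.commute power2_eq_square)
  moreover have "s * s < Im w * Im z" using wz s by (intro mult_strict_mono) auto
  ultimately show False by linarith
qed

text \<open>For \<open>Im \<zeta> = t > 2 s\<close> the map \<open>w \<mapsto> \<zeta> + m - F_remainder w\<close> preserves the half plane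
  \<open>Im w \<ge> t / 2\<close> and contracts it by the factor \<open>(2 s / t)^2\<close>.\<close>

lemma F_transform_surj:
  assumes "2 * s < Im \<zeta>"
  shows "\<exists>w. s < Im w \<and> F_transform M w = \<zeta>"
proof -
  define t where "t = Im \<zeta>"
  define m where "m = (\<integral>x. x \<partial>M)"
  define S where "S = {w. t / 2 \<le> Im w}"
  \<comment> \<open>The fixed points of \<open>T\<close> are the solutions of
    \<open>F_transform M w = \<zeta>\<close>.\<close>
  define T where "T w = \<zeta> + complex_of_real m - F_remainder w" for w
  have t: "2 * s < t" "0 < t" using assms s by (auto simp: t_def)
  \<comment> \<open>Used twice: on \<open>S\<close> it gives
    \<open>|H| \<le> s^2 / (t / 2) \<le> t / 2\<close>, so \<open>T\<close> maps \<open>S\<close> to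
    itself, and it makes the contraction factor less than 1.\<close>
  have s2: "4 * s\<^sup>2 < t\<^sup>2" using t s power_strict_mono[of "2 * s" t 2] by simp
  have "closed S" unfolding S_def by (rule closed_halfspace_Im_ge)
  note complete_eq_closed[THEN iffD2, OF this]
  moreover have "S \<noteq> {}" using t by (auto simp: S_def t_def intro!: exI[of _ \<zeta>])
  moreover have "0 \<le> 4 * s\<^sup>2 / t\<^sup>2" "4 * s\<^sup>2 / t\<^sup>2 < 1" using s2 t by auto
  moreover have "T ` S \<subseteq> S"
  proof safe
    fix w assume "w \<in> S"
    then have w: "t / 2 \<le> Im w" by (simp add: S_def)
    with t have w0: "0 < Im w" by linarith
    have "cmod (F_remainder w) * (t / 2) \<le> cmod (F_remainder w) * Im w"
      using w by (intro mult_left_mono) auto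
    also have "\<dots> \<le> s\<^sup>2" using F_remainder_bound[OF w0 int] s by simp
    also have "\<dots> \<le> t / 2 * (t / 2)" using s2 by (simp add: power2_eq_square)
    finally have "cmod (F_remainder w) \<le> t / 2" using t by simp
    then show "T w \<in> S" using abs_Im_le_cmod[of "F_remainder w"] by (simp add: T_def S_def t_def)
  qed
  moreover have "dist (T w) (T z) \<le> 4 * s\<^sup>2 / t\<^sup>2 * dist w z" if "w \<in> S" "z \<in> S" for w z
  proof -
    have wz: "t / 2 \<le> Im w" "t / 2 \<le> Im z" using that by (auto simp: S_def)
    have "cmod (F_remainder w - F_remainder z) * (t / 2 * (t / 2))
        \<le> cmod (F_remainder w - F_remainder z) * (Im w * Im z)"
      using wz t by (intro mult_left_mono mult_mono) auto
    also have "\<dots> \<le> s\<^sup>2 * cmod (w - z)"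
      using F_remainder_lipschitz[OF _ _ int, of w z] wz t s by simp
    finally have "cmod (F_remainder w - F_remainder z) \<le> 4 * s\<^sup>2 / t\<^sup>2 * cmod (w - z)"
      using t by (simp add: field_simps power2_eq_square)
    then show ?thesis by (simp add: T_def dist_norm norm_minus_commute)
  qed
  ultimately have "\<exists>!w\<in>S. T w = w" by (rule Banach_fix)
  then obtain w where w: "w \<in> S" "T w = w" by blast
  then have "F_transform M w = \<zeta>"
    by (simp add: F_transform_eq T_def m_def[symmetric] algebra_simps)
  moreover have "s < Im w" using w(1) t by (simp add: S_def)
  ultimately show ?thesis by blast
qed

text \<open>The given transform is that of \<open>M\<close> conjugated by the translation by
  \<open>a - \<i> * b\<close>, so its inverse is the conjugated inverse of
  \<open>F_transform M\<close>. The translation lifts the upper half plane above height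
  \<open>b \<ge> 2 * s\<close>, where that inverse is defined.\<close>

lemma class_UI_shifted:
  assumes b: "2 * s \<le> b"
    and F\<nu>: "\<And>z. 0 < Im z \<Longrightarrow> F_transform \<nu> z =
      F_transform M (z - complex_of_real a + \<i> * complex_of_real b) + complex_of_real a - \<i> * complex_of_real b"
  shows "class_UI \<nu>"
proof -
  let ?c = "complex_of_real a - \<i> * complex_of_real b"
  let ?S = "{w. s < Im w}"
  define m where "m = (\<integral>x. x \<partial>M)"
  \<comment> \<open>\<open>L\<close> will bound \<open>|\<phi> z - z| = |m - H w|\<close>, as
    \<open>|H w| \<le> s^2 / Im w \<le> s\<close> above height \<open>s\<close>.\<close>
  define L where "L = \<bar>m\<bar> + s"
  have F\<nu>': "F_transform \<nu> z = F_transform M (z - ?c) + ?c" if "0 < Im z" for z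
    using F\<nu>[OF that] by (simp add: algebra_simps)
  have "F_transform M holomorphic_on ?S"
    using F_transform_holomorphic by (rule holomorphic_on_subset) (use s in \<open>auto simp: upper_half_def\<close>)
  from holomorphic_has_inverse[OF this open_halfspace_Im_gt inj_on_F_transform]
  obtain g where g: "g holomorphic_on F_transform M ` ?S" "\<And>w. w \<in> ?S \<Longrightarrow> g (F_transform M w) = w"
    by metis
  have inv: "s < Im (g \<zeta>) \<and> F_transform M (g \<zeta>) = \<zeta>" if "2 * s < Im \<zeta>" for \<zeta>
    using F_transform_surj[OF that] g(2) by auto
  define \<phi> where "\<phi> z = g (z - ?c) + ?c" for z
  have \<phi>: "s < Im (g (z - ?c))" "F_transform M (\<phi> z - ?c) = z - ?c" if "0 < Im z" for z
    using inv[of "z - ?c"] that b by (auto simp: \<phi>_def)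
  have "\<phi> holomorphic_on upper_half"
  proof -
    have "(\<lambda>z. z - ?c) ` upper_half \<subseteq> F_transform M ` ?S"
    proof safe
      fix z assume "z \<in> upper_half"
      then have "2 * s < Im (z - ?c)" using b by (simp add: upper_half_def)
      from F_transform_surj[OF this] show "z - ?c \<in> F_transform M ` ?S" by force
    qed
    then have "(\<lambda>z. g (z - ?c)) holomorphic_on upper_half"
      by (intro holomorphic_on_compose_gen[OF _ g(1), unfolded o_def] holomorphic_intros)
    then show ?thesis unfolding \<phi>_def by (rule holomorphic_on_add[OF _ holomorphic_on_const])
  qed
  moreover have "inj_on \<phi> upper_half"
  proof (rule inj_onI)
    fix y z assume yz: "y \<in> upper_half" "z \<in> upper_half" "\<phi> y = \<phi> z"
    then have im: "0 < Im y" "0 < Im z" by (auto simp: upper_half_def)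
    have "y - ?c = F_transform M (\<phi> y - ?c)" by (rule \<phi>(2)[OF im(1), symmetric])
    also have "\<dots> = z - ?c" unfolding yz(3) by (rule \<phi>(2)[OF im(2)])
    finally show "y = z" by simp
  qed
  moreover have "inj_on (F_transform \<nu>) (trunc_cone 1 1)"
  proof (rule inj_onI)
    fix y z assume yz: "y \<in> trunc_cone 1 1" "z \<in> trunc_cone 1 1" "F_transform \<nu> y = F_transform \<nu> z"
    then have im: "0 < Im y" "0 < Im z" by (auto simp: trunc_cone_def)
    from yz(3) have "F_transform M (y - ?c) = F_transform M (z - ?c)"
      unfolding F\<nu>'[OF im(1)] F\<nu>'[OF im(2)] by (rule add_right_imp_eq)
    moreover have "y - ?c \<in> ?S" "z - ?c \<in> ?S" using im b s by auto
    ultimately show "y = z" using inj_onD[OF inj_on_F_transform] by fastforce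
  qed
  \<comment> \<open>A displacement by at most \<open>L\<close> leads from the narrow cone into the
    wide one: \<open>Im z / 2 + L < Im z - L\<close> because \<open>Im z > 4 * L\<close>, and
    \<open>Im z - L > 1\<close>.\<close>
  moreover have "\<phi> z \<in> trunc_cone 1 1 \<and> F_transform \<nu> (\<phi> z) = z" if "z \<in> trunc_cone (1/2) (4 * L + 2)" for z
  proof -
    have z: "0 < Im z" "\<bar>Re z\<bar> < Im z / 2" "4 * L + 2 < Im z"
      using that by (auto simp: trunc_cone_def)
    define w where "w = g (z - ?c)"
    have w: "s < Im w" "F_transform M w = z - ?c"
      using \<phi>[OF z(1)] by (auto simp: w_def \<phi>_def)
    have "cmod (F_remainder w) \<le> s"
    proof (cases "F_remainder w = 0")
      case False
      have "cmod (F_remainder w) * Im w \<le> s * s"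
        using F_remainder_bound[of w, OF _ int] w(1) s by (simp add: power2_eq_square)
      also have "\<dots> \<le> s * Im w" using w(1) s by (intro mult_left_mono) auto
      finally show ?thesis using w(1) s by simp
    qed (use s in simp)
    moreover have "w - m + F_remainder w = z - ?c"
      using w(2) unfolding F_transform_eq m_def .
    then have "\<phi> z - z = complex_of_real m - F_remainder w"
      unfolding \<phi>_def w_def[symmetric] by algebra
    ultimately have "cmod (\<phi> z - z) \<le> L"
      using norm_triangle_ineq4[of "complex_of_real m" "F_remainder w"] by (simp add: L_def)
    then have "\<bar>Re (\<phi> z) - Re z\<bar> \<le> L" "\<bar>Im (\<phi> z) - Im z\<bar> \<le> L"
      using abs_Re_le_cmod[of "\<phi> z - z"] abs_Im_le_cmod[of "\<phi> z - z"] by auto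
    moreover have "0 \<le> L" using s by (simp add: L_def)
    ultimately have "\<phi> z \<in> trunc_cone 1 1"
      using z unfolding trunc_cone_def by (auto simp: abs_if split: if_splits)
    moreover from this have "0 < Im (\<phi> z)" by (simp add: trunc_cone_def)
    then have "F_transform \<nu> (\<phi> z) = z" using F\<nu>' \<phi>(2)[OF z(1)] by simp
    ultimately show ?thesis by blast
  qed
  moreover have "0 < 4 * L + 2" using s by (simp add: L_def)
  ultimately show ?thesis
    unfolding class_UI_def by (intro exI[of _ \<phi>] conjI exI[of _ "1::real"] exI[of _ "1/2::real"] exI[of _ "4 * L + 2"]) auto
qed

text \<open>Equality in the Cauchy--Schwarz bound at one point forces the remainder to be
  constant, and then \<open>M\<close> (a point mass) is its own transform.\<close>

lemma ex_is_A_ab: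
  assumes b: "2 * s \<le> b"
  shows "\<exists>\<nu>. is_A_ab a b M \<nu>"
proof (cases "\<exists>w0. 0 < Im w0 \<and> Im (F_remainder w0) = 0")
  case True
  then obtain w0 where w0: "0 < Im w0" "Im (F_remainder w0) = 0" by blast
  have const: "F_remainder w = F_remainder w0" if "0 < Im w" for w
  proof -
    have "(cmod (F_remainder w - F_remainder w0))\<^sup>2 * (Im w * Im w0) \<le> 0"
      using F_remainder_diff[OF that w0(1)] w0(2) by simp
    then show ?thesis using that w0(1) by (auto simp: mult_le_0_iff)
  qed
  have "is_A_ab a b M M"
    unfolding is_A_ab_def real_prob_measure_def
  proof (intro conjI ballI)
    fix z assume "z \<in> upper_half"
    then have "0 < Im z" "0 < Im (z - complex_of_real a + \<i> * complex_of_real b)"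
      using b s by (auto simp: upper_half_def)
    then show "F_transform M z = F_transform M (z - complex_of_real a + \<i> * complex_of_real b)
        + complex_of_real a - \<i> * complex_of_real b"
      unfolding F_transform_eq using const by simp
  qed (auto intro: prob_space_axioms)
  then show ?thesis by blast
next
  case False
  have pos: "0 < Im (F_remainder w)" if "0 < Im w" for w
    using False Im_F_remainder_nonneg[OF that] that by force
  \<comment> \<open>If \<open>s = 0\<close>, then \<open>H\<close> vanishes. Hence
    \<open>b > 0\<close> here, and the shift carries the closed half plane into
    \<open>Im w \<ge> b\<close>, where \<open>H\<close> is holomorphic and bounded by
    \<open>s^2 / b\<close>.\<close>
  have "s \<noteq> 0"
  proof
    assume "s = 0"
    then have "cmod (F_remainder \<i>) \<le> 0" using F_remainder_bound[of \<i>, OF _ int] s by simp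
    then show False using pos[of \<i>] by simp
  qed
  then have b0: "0 < b" using b s by linarith
  let ?c = "complex_of_real a - \<i> * complex_of_real b"
  \<comment> \<open>The translation cancels in the linear part:
    \<open>F (z - c) + c = z - m + H (z - c)\<close>, so only the remainder is shifted.\<close>
  define h where "h z = F_remainder (z - ?c)" for z
  have im: "b \<le> Im (z - ?c)" "0 < Im (z - ?c)" if "0 \<le> Im z" for z using that b0 by auto
  have "F_remainder holomorphic_on upper_half"
    unfolding F_remainder_def[abs_def] using F_transform_holomorphic by (intro holomorphic_intros)
  moreover have "(\<lambda>z. z - ?c) ` {z. 0 \<le> Im z} \<subseteq> upper_half"
    using b0 by (auto simp: upper_half_def)
  ultimately have "h holomorphic_on {z. 0 \<le> Im z}"
    unfolding h_def
    by (rule holomorphic_on_compose_gen[OF holomorphic_on_diff[OF holomorphic_on_ident holomorphic_on_const], unfolded o_def])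
  moreover have "0 < Im (h z)" if "0 \<le> Im z" for z
    unfolding h_def by (rule pos[OF im(2)[OF that]])
  moreover have "cmod (h z) \<le> s\<^sup>2 / b" if "0 \<le> Im z" for z
  proof -
    have "cmod (h z) * b \<le> cmod (h z) * Im (z - ?c)" using im(1)[OF that] by (intro mult_left_mono) auto
    also have "\<dots> \<le> s\<^sup>2" using F_remainder_bound[OF im(2)[OF that] int] s by (simp add: h_def)
    finally show ?thesis using b0 by (simp add: field_simps)
  qed
  ultimately obtain \<nu> where \<nu>: "real_prob_measure \<nu>"
    "\<And>z. z \<in> upper_half \<Longrightarrow> F_transform \<nu> z = z - complex_of_real (\<integral>x. x \<partial>M) + h z"
    using ex_measure_F_transform by blast
  have "is_A_ab a b M \<nu>"
    unfolding is_A_ab_def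
  proof (intro conjI ballI \<nu>(1))
    fix z assume "z \<in> upper_half"
    have eq: "z - ?c = z - complex_of_real a + \<i> * complex_of_real b" by simp
    show "F_transform \<nu> z = F_transform M (z - complex_of_real a + \<i> * complex_of_real b)
        + complex_of_real a - \<i> * complex_of_real b"
      unfolding \<nu>(2)[OF \<open>z \<in> upper_half\<close>] F_transform_eq h_def eq by simp
  qed
  then show ?thesis by blast
qed

end

end

text \<open>Existence is included so that the statement about all \<open>\<nu>\<close> is not
  vacuous.\<close>

theorem mainTheorem18:
  fixes \<mu> :: "real measure" and a b :: real
  assumes "real_prob_measure \<mu>"
    and "integrable \<mu> (\<lambda>x. x ^ 2)"
    and "b \<ge> 2 * sqrt (\<integral>x. (x - (\<integral>y. y \<partial>\<mu>)) ^ 2 \<partial>\<mu>)"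
  shows "(\<exists>\<nu>. is_A_ab a b \<mu> \<nu>) \<and> (\<forall>\<nu>. is_A_ab a b \<mu> \<nu> \<longrightarrow> class_UI \<nu>)"
proof -
  interpret real_distribution \<mu>
    using assms(1) by (simp add: real_prob_measure_def real_distribution_def real_distribution_axioms_def)
  define s where "s = sqrt (\<integral>x. (x - (\<integral>y. y \<partial>\<mu>))\<^sup>2 \<partial>\<mu>)"
  have s: "0 \<le> s" "variance (\<lambda>x. x) = s\<^sup>2"
    by (simp_all add: s_def Bochner_Integration.integral_nonneg)
  have b: "2 * s \<le> b" using assms(3) by (simp add: s_def)
  show ?thesis
    using ex_is_A_ab[OF assms(2) s b] class_UI_shifted[OF assms(2) s b]
    by (auto simp: is_A_ab_def upper_half_def)
qed

end
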